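(* For all integers $h \geq 2$, $m \geq h$, $0 \leq x \leq h$, and $n \geq 0$, whenever $\lambda_m(x) \in \mathbb{Z}$ and $h \mid \lambda_m(x)$, we have $$\binom{x+n}{n} \equiv \sum_{i=1}^{n} \binom{x+m}{i}\binom{x+n-i}{n-i}\cdot\frac{m!}{(m-i)!}\cdot\frac{(2m-1-i)!}{(2m-1)!}(-1)^{i+1} + \binom{x+n-m}{n}\binom{m-1}{n}\binom{2m-1}{n}^{-1}[0\leq n<m] \pmod{h}.$$
   Context: $\binom{y}{k} = y(y-1)\cdots(y-k+1)/k!$ for integers $k\ge 0$ and arbitrary (possibly negative) $y$. For integers $h\ge 2$, $$\lambda_h(x) := \prod_{i=2}^{h}\mathrm{ab}_{x,i},\qquad \mathrm{ab}_{x,2} := -\tfrac12 x(x+1),\qquad \mathrm{ab}_{x,i} := -\frac{1}{4(2i-3)^2}(x-i+2)(x+i-1)\ \ (i\ge 3),$$ equivalently $$\lambda_h(x) = \frac{(-1)^{h-1}}{2}\binom{x+h-1}{h-1}\binom{x}{h-1}\binom{2h-3}{h-2}^{-2}.$$ Conventions: $[0\le n<m]$ equals $1$ if $0\le n<m$ and $0$ otherwise, and the term containing it is $0$ when the condition fails; summands with $i>m$ are $0$ (since $1/(m-i)!$ is read as $0$). The right-hand side is a priori a rational number; for rational numbers $a,b$, $a\equiv b \pmod h$ means $(a-b)/h\in\mathbb{Z}$. *)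

theory Defs
  imports Complex_Main
begin

definition ab :: "rat \<Rightarrow> nat \<Rightarrow> rat" where
  "ab x i = (if i = 2 then - (1 / 2) * x * (x + 1)
             else - (1 / (4 * (2 * of_nat i - 3)\<^sup>2)) * (x - of_nat i + 2) * (x + of_nat i - 1))"

definition lambda_poly :: "nat \<Rightarrow> rat \<Rightarrow> rat" where
  "lambda_poly h x = (\<Prod>i = 2..h. ab x i)"

(* Divisibility in the field rat is trivial, so the quotient by the modulus
   is required to lie in the ring of integers. *)
definition rat_cong :: "rat \<Rightarrow> rat \<Rightarrow> nat \<Rightarrow> bool" where
  "rat_cong a b h \<longleftrightarrow> (a - b) / of_nat h \<in> \<int>"

end

theory Submission
  imports Defs "HOL-Computational_Algebra.Formal_Power_Series"
begin

text \<open>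
  Write \<open>f(z) = (1 - z)^(-(x + 1))\<close>, whose coefficients are \<open>(x + n) choose n\<close>.  Up to
  signs, the factors in the sum over \<open>i\<close> that do not depend on \<open>n\<close> are the
  coefficients of the polynomial \<open>Q(z) = 2F1(-m, -(x + m); 1 - 2 m; z)\<close>, and the last summand is
  the coefficient of \<open>z^n\<close> in \<open>P(z) = 2F1(1 - m, 1 + x - m; 1 - 2 m; z)\<close>.  Here
  \<open>P / Q\<close> is the Pade approximant of \<open>f\<close> with numerator degree at most \<open>m - 1\<close> and
  denominator degree at most \<open>m\<close>, and the congruence compares the coefficients of \<open>z^n\<close> in \<open>f\<close> and in
  \<open>P - (Q - 1) f\<close>.

  The proof rests on two facts.  The first is that the hypothesis on \<^const>\<open>lambda_poly\<close> leaves
  only the range \<open>x + 2 \<le> m\<close>, in which \<^const>\<open>lambda_poly\<close> vanishes: since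
  \<open>x \<le> h \<le> m\<close>, the only other cases are \<open>x = m - 1\<close> and \<open>x = m\<close>, and there
  its value is nonzero and either too small to be a multiple of \<open>h\<close>, or \<open>3\<close> in absolute value with
  \<open>h = 2\<close> (\<open>lambda_poly_divisible_imp_bound\<close>).

  The second is that for \<open>x + 2 \<le> m\<close> the Pade approximant is exact, so that the two sides of the
  congruence are equal.  Indeed Euler's transformation
  \<open>2F1(c - a, c - b; c; z) = (1 - z)^(a + b - c) 2F1(a, b; c; z)\<close> with
  \<open>a = 1 - m\<close>, \<open>b = 1 + x - m\<close>, \<open>c = 1 - 2 m\<close> says
  \<open>Q = (1 - z)^(x + 1) P\<close>, that is \<open>Q f = P\<close>.  As \<open>c\<close> is a negative integer, the
  transformation needs an argument beyond the usual one by differential equations: the recurrence for the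
  coefficients breaks down at degree \<open>2 m - 1\<close>, but both sides are polynomials of degree at most
  \<open>m\<close> (\<open>euler_transformation_nonpos_int\<close>).
\<close>

section \<open>Hypergeometric coefficients and the hypergeometric operator\<close>

text \<open>
  The Taylor coefficients of the Gauss series \<open>2F1(a, b; c; z)\<close>.  For \<open>c = -N\<close> the
  denominator vanishes from \<open>n = N + 1\<close> on, and division by zero makes these coefficients \<open>0\<close>: if
  in addition \<open>a\<close> is one of \<open>0, -1, ..., -N\<close>, the series is the terminating polynomial that
  one wants.
\<close>

definition hyper_coeff :: "'a::field_char_0 \<Rightarrow> 'a \<Rightarrow> 'a \<Rightarrow> nat \<Rightarrow> 'a" where
  "hyper_coeff a b c n =
     pochhammer a n * pochhammer b n / (pochhammer c n * fact n)"

lemma hyper_coeff_0 [simp]: "hyper_coeff a b c 0 = 1"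
  by (simp add: hyper_coeff_def)

text \<open>
  The hypothesis says that the numerator dies no later than the denominator.  It is what keeps the
  recurrence true at the pole \<open>n = -c\<close>, where the left-hand side is \<open>0\<close>.
\<close>

lemma hyper_coeff_recurrence:
  assumes "\<And>n. pochhammer c n = 0 \<Longrightarrow> pochhammer a n = 0"
  shows "of_nat (Suc n) * (of_nat n + c) * hyper_coeff a b c (Suc n)
       = (of_nat n + a) * (of_nat n + b) * hyper_coeff a b c n"
proof (cases "pochhammer c (Suc n) = 0")
  case True
  then have "(of_nat n + a) * hyper_coeff a b c n = 0"
    using assms[of "Suc n"] by (auto simp: pochhammer_Suc hyper_coeff_def add.commute)
  with True show ?thesis
    by (auto simp: hyper_coeff_def)
next
  case False
  then have "pochhammer c n \<noteq> 0" "c + of_nat n \<noteq> 0"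
    by (auto simp: pochhammer_Suc)
  then show ?thesis
    by (simp add: hyper_coeff_def pochhammer_Suc divide_simps del: of_nat_Suc)
       (simp add: algebra_simps)
qed

text \<open>
  The hypergeometric differential operator
  \<open>z (1 - z) F'' + (c - (a + b + 1) z) F' - a b F\<close>.
\<close>

definition hyper_op :: "'a::field_char_0 \<Rightarrow> 'a \<Rightarrow> 'a \<Rightarrow> 'a fps \<Rightarrow> 'a fps" where
  "hyper_op a b c F =
     fps_X * (1 - fps_X) * fps_deriv (fps_deriv F)
     + (fps_const c - fps_const (a + b + 1) * fps_X) * fps_deriv F
     - fps_const (a * b) * F"

lemma hyper_op_nth:
  "fps_nth (hyper_op a b c F) n
     = of_nat (Suc n) * (of_nat n + c) * fps_nth F (Suc n)
       - (of_nat n + a) * (of_nat n + b) * fps_nth F n"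
proof (cases n)
  case 0
  then show ?thesis
    by (simp add: hyper_op_def algebra_simps)
next
  case (Suc k)
  then show ?thesis
    by (cases k) (simp_all add: hyper_op_def algebra_simps mult.assoc)
qed

lemma hyper_op_hyper_coeff_eq_0:
  assumes "\<And>n. pochhammer c n = 0 \<Longrightarrow> pochhammer a n = 0"
  shows "hyper_op a b c (Abs_fps (hyper_coeff a b c)) = 0"
  using hyper_coeff_recurrence[of c a _ b, OF assms] by (intro fps_ext) (simp add: hyper_op_nth)

text \<open>
  This is the reason for Euler's transformation: conjugating the hypergeometric operator with the power
  \<open>(1 - z)^(a + b - c)\<close> gives the hypergeometric operator with parameters
  \<open>c - a, c - b, c\<close>.
\<close>

lemma hyper_op_power_mult:
  fixes a b c :: "'a::field_char_0"
  assumes c: "c + of_nat k = a + b"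
  shows "hyper_op (c - a) (c - b) c ((1 - fps_X) ^ k * F)
       = (1 - fps_X) ^ k * hyper_op a b c F"
proof -
  define y :: "'a fps" where "y = 1 - fps_X"
  define E where "E = y ^ k"
  define E1 where "E1 = fps_deriv E"
  define E2 where "E2 = fps_deriv E1"
  have dy: "fps_deriv y = - 1"
    by (simp add: y_def)
  have E1: "y * E1 = - of_nat k * E"
    unfolding E1_def E_def
    by (induction k) (simp_all add: dy algebra_simps)
  have "fps_deriv (y * E1) = fps_deriv (- of_nat k * E)"
    by (simp only: E1)
  then have E2: "y * E2 = (1 - of_nat k) * E1"
    by (simp add: dy E2_def E1_def[symmetric] algebra_simps)
  have E2': "y * y * E2 = - (1 - of_nat k) * of_nat k * E"
    by (simp only: mult.assoc E2 mult.left_commute[of y] E1) (simp add: algebra_simps)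
  define A B C K where "A = fps_const a" and "B = fps_const b" and "C = fps_const c"
    and "K = (of_nat k :: 'a fps)"
  have K: "K = fps_const (of_nat k)"
    by (simp add: K_def fps_of_nat)
  have c': "c = a + b - of_nat k"
    using c by (simp add: algebra_simps)
  have C: "C = A + B - K"
    by (simp add: A_def B_def C_def K c' flip: fps_const_add fps_const_sub)
  have const_eqs: "fps_const ((c - a) + (c - b) + 1) = A + B - 2 * K + 1"
      "fps_const ((c - a) * (c - b)) = (B - K) * (A - K)"
      "fps_const (a + b + 1) = A + B + 1" "fps_const (a * b) = A * B"
    by (simp_all add: A_def B_def K c' numeral_fps_const
        flip: fps_const_add fps_const_sub fps_const_mult fps_const_1_eq_1)
  have X: "fps_X = 1 - y"
    by (simp add: y_def)
  define D1 D2 where "D1 = fps_deriv F" and "D2 = fps_deriv D1"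
  have d1: "fps_deriv (E * F) = E * D1 + E1 * F"
    by (simp add: D1_def E1_def)
  have d2: "fps_deriv (fps_deriv (E * F)) = E * D2 + 2 * (E1 * D1) + E2 * F"
    unfolding d1 by (simp add: D1_def D2_def E1_def E2_def)
  \<comment> \<open>Without the factor \<open>y\<close> the derivatives of \<open>E\<close>, which would bring in
    \<open>y ^ (k - 1)\<close> and \<open>y ^ (k - 2)\<close>, could not be eliminated.\<close>
  have "y * ((1 - y) * y * (E * D2 + 2 * (E1 * D1) + E2 * F)
           + (C - (A + B - 2 * K + 1) * (1 - y)) * (E * D1 + E1 * F)
           - (B - K) * (A - K) * (E * F))
      = y * (E * ((1 - y) * y * D2 + (C - (A + B + 1) * (1 - y)) * D1 - A * B * F))"
    using E1[folded K_def] E2'[folded K_def] C by algebra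
  moreover have "y \<noteq> 0"
    using fps_nonzeroI[of y 0] by (simp add: y_def)
  ultimately show ?thesis
    unfolding hyper_op_def const_eqs y_def[symmetric] E_def[symmetric] d2
    unfolding d1 D1_def[symmetric] D2_def[symmetric] C_def[symmetric]
    by (simp add: X)
qed

section \<open>Euler's transformation for nonpositive integer parameters\<close>

lemma fps_nth_one_minus_X_power_mult_eq_0:
  fixes F :: "'a::comm_ring_1 fps"
  assumes "\<And>n. n > d \<Longrightarrow> fps_nth F n = 0"
  shows "n > d + k \<Longrightarrow> fps_nth ((1 - fps_X) ^ k * F) n = 0"
proof (induction k arbitrary: n)
  case 0
  then show ?case
    using assms by simp
next
  case (Suc k)
  have "(1 - fps_X) ^ Suc k * F = (1 - fps_X) ^ k * F - fps_X * ((1 - fps_X) ^ k * F)"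
    by (simp add: algebra_simps)
  then show ?case
    using Suc by (simp add: fps_X_mult_nth)
qed

text \<open>
  Euler's transformation
  \<open>2F1(c - a, c - b; c; z) = (1 - z)^(a + b - c) 2F1(a, b; c; z)\<close> for \<open>a = -p\<close>,
  \<open>b = -q\<close>, \<open>c = -N\<close>.  Both sides solve the same differential equation, hence their
  coefficients obey the same recurrence and agree up to degree \<open>N\<close>.  At \<open>n = N\<close> the
  recurrence degenerates and no longer determines the next coefficient; this is where
  \<open>p + q \<le> N\<close> enters, since it makes both sides polynomials of degree at most \<open>N\<close>.
\<close>

lemma euler_transformation_nonpos_int:
  fixes p q N :: nat
  assumes "p + q \<le> N"
  shows "Abs_fps (hyper_coeff (- of_nat (N - p)) (- of_nat (N - q)) (- of_nat N))
       = (1 - fps_X) ^ (N - p - q)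
         * (Abs_fps (hyper_coeff (- of_nat p) (- of_nat q) (- of_nat N)) :: 'a::field_char_0 fps)"
    (is "Abs_fps ?f = _ * Abs_fps ?g")
proof -
  define F :: "'a fps" where "F = (1 - fps_X) ^ (N - p - q) * Abs_fps ?g"
  have pole: "pochhammer (- of_nat N) n = (0 :: 'a) \<Longrightarrow> pochhammer (- of_nat d) n = (0 :: 'a)"
    if "d \<le> N" for d n
    using that by (simp add: pochhammer_of_nat_eq_0_iff)
  have "hyper_op (- of_nat N - - of_nat p) (- of_nat N - - of_nat q) (- of_nat N) F = 0"
    unfolding F_def using assms pole[of p]
    by (subst hyper_op_power_mult) (simp_all add: hyper_op_hyper_coeff_eq_0 of_nat_diff)
  then have "hyper_op (- of_nat (N - p)) (- of_nat (N - q)) (- of_nat N) F = 0"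
    using assms by (simp add: of_nat_diff)
  then have F_rec: "of_nat (Suc n) * (of_nat n + - of_nat N) * fps_nth F (Suc n)
      = (of_nat n + - of_nat (N - p)) * (of_nat n + - of_nat (N - q)) * fps_nth F n" for n
    using hyper_op_nth[of "- of_nat (N - p)" "- of_nat (N - q)" "- of_nat N" F n] by simp
  have f_rec: "of_nat (Suc n) * (of_nat n + - of_nat N) * ?f (Suc n)
      = (of_nat n + - of_nat (N - p)) * (of_nat n + - of_nat (N - q)) * ?f n" for n
    using pole[of "N - p"] by (intro hyper_coeff_recurrence) simp
  have low: "n \<le> N \<Longrightarrow> fps_nth F n = ?f n" for n
  proof (induction n)
    case 0
    show ?case by (simp add: F_def fps_power_zeroth)
  next
    case (Suc n)
    then have "of_nat (Suc n) * (of_nat n + - of_nat N) \<noteq> (0 :: 'a)"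
      by (simp add: add_eq_0_iff del: of_nat_Suc)
    moreover have "of_nat (Suc n) * (of_nat n + - of_nat N) * fps_nth F (Suc n)
        = of_nat (Suc n) * (of_nat n + - of_nat N) * ?f (Suc n)"
      using Suc by (simp only: F_rec f_rec)
    ultimately show ?case
      by simp
  qed
  have high: "fps_nth F n = ?f n" if "n > N" for n
  proof -
    have "fps_nth F n = 0"
      unfolding F_def
      by (rule fps_nth_one_minus_X_power_mult_eq_0[of p])
         (use that assms in \<open>auto simp: hyper_coeff_def pochhammer_of_nat_eq_0_iff\<close>)
    with that show ?thesis
      by (simp add: hyper_coeff_def pochhammer_of_nat_eq_0_iff)
  qed
  show ?thesis
    unfolding F_def[symmetric] using low high by (intro fps_ext) (metis fps_nth_Abs_fps not_le)
qed

section \<open>Coefficients in terms of binomials\<close>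

lemma pochhammer_minus_of_nat:
  assumes "i \<le> N"
  shows "pochhammer (- of_nat N) i = ((-1) ^ i * fact N / fact (N - i) :: 'a::field_char_0)"
proof -
  have "(-1) ^ i * pochhammer (- of_nat N) i = fact i * (of_nat (N choose i) :: 'a)"
    by (simp add: binomial_gbinomial gbinomial_pochhammer)
  also have "\<dots> = fact N / fact (N - i)"
    by (simp add: binomial_fact[OF assms])
  finally have "(-1) ^ i * ((-1) ^ i * pochhammer (- of_nat N :: 'a) i)
      = (-1) ^ i * (fact N / fact (N - i))"
    by (rule arg_cong)
  then show ?thesis
    by simp
qed

text \<open>
  The terminating coefficients in terms of factorials and binomial coefficients: first with \<open>b\<close>
  also a nonpositive integer, then with \<open>b\<close> arbitrary.
\<close>

lemma hyper_coeff_nonpos_int: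
  assumes "A \<le> N"
  shows "hyper_coeff (- of_nat A) (- of_nat B) (- of_nat N) i
    = (if i \<le> A
       then (-1) ^ i * of_nat (B choose i) * (fact A / fact (A - i)) * (fact (N - i) / fact N)
       else (0 :: 'a::field_char_0))"
proof (cases "i \<le> A")
  case True
  have "(of_nat (B choose i) :: 'a) = (-1) ^ i * pochhammer (- of_nat B) i / fact i"
    by (simp add: binomial_gbinomial gbinomial_pochhammer)
  with True assms show ?thesis
    by (simp add: hyper_coeff_def pochhammer_minus_of_nat divide_simps)
next
  case False
  then show ?thesis
    by (simp add: hyper_coeff_def pochhammer_of_nat_eq_0_iff)
qed

lemma hyper_coeff_nonpos_int_gbinomial:
  assumes "A \<le> N"
  shows "hyper_coeff (- of_nat A) b (- of_nat N) n
    = (if n \<le> A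
       then ((b + of_nat n - 1) gchoose n) * of_nat (A choose n) * inverse (of_nat (N choose n))
       else (0 :: 'a::field_char_0))"
proof (cases "n \<le> A")
  case True
  have "pochhammer (- of_nat M :: 'a) n = (-1) ^ n * fact n * of_nat (M choose n)" for M
    by (simp add: binomial_gbinomial gbinomial_pochhammer)
  with True assms show ?thesis
    by (simp add: hyper_coeff_def gbinomial_pochhammer' divide_simps)
next
  case False
  then show ?thesis
    by (simp add: hyper_coeff_def pochhammer_of_nat_eq_0_iff)
qed

text \<open>
  The series of \<open>(1 - z)^(-(x + 1))\<close>.  Each factor \<open>1 - z\<close> lowers \<open>x\<close> by
  one, by Pascal's rule.
\<close>

lemma one_minus_fps_X_power_mult_binomial:
  "(1 - fps_X) ^ Suc x * Abs_fps (\<lambda>n. of_nat ((x + n) choose n)) = (1 :: 'a::comm_ring_1 fps)"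
proof (induction x)
  case 0
  show ?case
    by (rule fps_ext) (simp add: algebra_simps)
next
  case (Suc x)
  have "(1 - fps_X) * Abs_fps (\<lambda>n. of_nat ((Suc x + n) choose n))
      = (Abs_fps (\<lambda>n. of_nat ((x + n) choose n)) :: 'a fps)"
  proof (rule fps_ext)
    fix n
    show "fps_nth ((1 - fps_X) * Abs_fps (\<lambda>n. of_nat ((Suc x + n) choose n))) n
      = fps_nth (Abs_fps (\<lambda>n. of_nat ((x + n) choose n)) :: 'a fps) n"
      by (cases n) (simp_all add: algebra_simps)
  qed
  with Suc show ?case
    by (simp add: power_Suc2 mult.assoc del: power_Suc)
qed

section \<open>Consequences of the divisibility hypothesis\<close>

text \<open>
  The ratio of consecutive binomial coefficients \<open>(2 k + 1) choose k\<close>; these occur squared in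
  the denominator of the closed form of \<^const>\<open>lambda_poly\<close>.
\<close>

lemma odd_central_binomial_step:
  "(k + 2) * ((2 * Suc k + 1) choose Suc k) = 2 * (2 * k + 3) * ((2 * k + 1) choose k)"
proof -
  have index: "2 * (k + 1) + 1 = 2 * k + 3"
    by simp
  \<comment> \<open>Pass through \<open>(2 k + 2) choose k\<close>: lower both entries, then only the upper one.\<close>
  have 1: "(k + 1) * ((2 * k + 3) choose (k + 1)) = (2 * k + 3) * ((2 * k + 2) choose k)"
    using Suc_times_binomial[of k "2 * k + 2"] by (simp add: numeral_eq_Suc)
  have 2: "(k + 2) * ((2 * k + 2) choose k) = (2 * k + 2) * ((2 * k + 1) choose k)"
    using binomial_absorb_comp[of "2 * k + 2" k] by (simp add: numeral_eq_Suc)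
  have "(k + 1) * ((k + 2) * ((2 * k + 3) choose (k + 1)))
      = (k + 1) * (2 * (2 * k + 3) * ((2 * k + 1) choose k))"
    using 1 2 by algebra
  then have "(k + 2) * ((2 * k + 3) choose (k + 1)) = 2 * (2 * k + 3) * ((2 * k + 1) choose k)"
    by (subst (asm) mult_cancel1) (simp del: binomial_Suc_Suc)
  then show ?thesis
    by (simp only: Suc_eq_plus1 index)
qed

lemma odd_central_binomial_ge:
  assumes "k \<ge> 1"
  shows "2 * k + 1 \<le> (2 * k + 1) choose k"
  using assms
proof (induction k rule: dec_induct)
  case base
  show ?case by (simp add: numeral_eq_Suc)
next
  case (step k)
  have "(k + 2) * (2 * Suc k + 1) \<le> 2 * (2 * k + 3) * (2 * k + 1)"
    by (simp add: algebra_simps)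
  also have "\<dots> \<le> 2 * (2 * k + 3) * ((2 * k + 1) choose k)"
    by (intro mult_left_mono step) simp
  also have "\<dots> = (k + 2) * ((2 * Suc k + 1) choose Suc k)"
    by (rule odd_central_binomial_step [symmetric])
  finally show ?case
    by (simp only: mult_le_cancel1)
qed

text \<open>
  By induction: passing from \<open>k\<close> to \<open>k + 1\<close> multiplies the right-hand side by the new factor
  \<open>ab x (k + 3)\<close>.
\<close>

lemma lambda_poly_closed_form:
  "lambda_poly (k + 2) (of_nat x)
     = (-1) ^ Suc k / 2 * of_nat ((x + k + 1) choose (k + 1)) * of_nat (x choose (k + 1))
       / (of_nat ((2 * k + 1) choose k))\<^sup>2"
proof (induction k)
  case 0
  show ?case
    by (simp add: lambda_poly_def ab_def algebra_simps)
next
  case (Suc k)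
  define p q r where "p = (of_nat ((x + k + 1) choose (k + 1)) :: rat)"
    and "q = (of_nat (x choose (k + 1)) :: rat)"
    and "r = (of_nat ((2 * k + 1) choose k) :: rat)"
  define p' q' r' where "p' = (of_nat ((x + Suc k + 1) choose (Suc k + 1)) :: rat)"
    and "q' = (of_nat (x choose (Suc k + 1)) :: rat)"
    and "r' = (of_nat ((2 * Suc k + 1) choose Suc k) :: rat)"
  have "(k + 2) * ((x + Suc k + 1) choose (Suc k + 1)) = (x + k + 2) * ((x + k + 1) choose (k + 1))"
    using Suc_times_binomial[of "k + 1" "x + k + 1"] by simp
  then have "of_nat (k + 2) * p' = of_nat (x + k + 2) * p"
    unfolding p_def p'_def by (metis of_nat_mult)
  then have p': "p' = of_nat (x + k + 2) * p / of_nat (k + 2)"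
    by (subst nonzero_eq_divide_eq) (auto simp: mult_ac simp del: of_nat_add)
  have q': "q' = (of_nat x - of_nat (k + 1)) * q / of_nat (k + 2)"
    using gbinomial_mult_1[of "of_nat x :: rat" "k + 1"]
    unfolding q_def q'_def by (simp add: binomial_gbinomial field_simps)
  have "(k + 2) * ((2 * Suc k + 1) choose Suc k) = 2 * (2 * k + 3) * ((2 * k + 1) choose k)"
    by (rule odd_central_binomial_step)
  then have "of_nat (k + 2) * r' = 2 * of_nat (2 * k + 3) * r"
    unfolding r_def r'_def by (metis of_nat_mult of_nat_numeral)
  then have r': "r' = 2 * of_nat (2 * k + 3) * r / of_nat (k + 2)"
    by (subst nonzero_eq_divide_eq) (auto simp: mult_ac simp del: of_nat_add)
  have "r \<noteq> 0"
    by (simp add: r_def)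
  have linear: "2 * of_nat (k + 3) - 3 = rat_of_nat (2 * k + 3)"
      "of_nat x - of_nat (k + 3) + 2 = rat_of_nat x - of_nat (k + 1)"
      "of_nat x + of_nat (k + 3) - 1 = rat_of_nat (x + k + 2)"
    by simp_all
  have "lambda_poly (Suc k + 2) (of_nat x) = lambda_poly (k + 2) (of_nat x) * ab (of_nat x) (k + 3)"
    by (simp add: lambda_poly_def numeral_eq_Suc)
  also have "\<dots> = (-1) ^ Suc k / 2 * p * q / r\<^sup>2 * ab (of_nat x) (k + 3)"
    by (simp only: Suc.IH p_def q_def r_def)
  also have "ab (of_nat x) (k + 3)
      = - ((of_nat x - of_nat (k + 1)) * of_nat (x + k + 2) / (2 * of_nat (2 * k + 3))\<^sup>2)"
    unfolding ab_def linear by (simp add: power_mult_distrib del: of_nat_add)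
  also have "(-1) ^ Suc k / 2 * p * q / r\<^sup>2 * \<dots> = (-1) ^ Suc (Suc k) / 2 * p' * q' / r'\<^sup>2"
    unfolding p' q' r' using \<open>r \<noteq> 0\<close>
    by (simp add: divide_simps power2_eq_square del: of_nat_add)
  finally show ?case
    unfolding p'_def q'_def r'_def .
qed

text \<open>
  For \<open>x + 2 \<le> m\<close> the product \<^const>\<open>lambda_poly\<close> contains the factor
  \<open>x - i + 2\<close> with \<open>i = x + 2\<close> and vanishes.  Only \<open>x = m - 1\<close> and \<open>x = m\<close> remain,
  and there the closed form collapses to \<open>1 / r\<close> and \<open>(2 m - 1) / r\<close> in absolute value, with
  \<open>r = (2 m - 3) choose (m - 2)\<close>.  A nonzero multiple of \<open>h\<close> has absolute value at least
  \<open>2\<close>, but these values are less than \<open>2\<close> because \<open>r \<ge> 2 m - 3\<close> for \<open>m \<ge> 3\<close>; the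
  one exception is the value \<open>3\<close> for \<open>m = x = 2\<close>, and it is not divisible by
  \<open>h = 2\<close>.
\<close>

lemma lambda_poly_divisible_imp_bound:
  assumes "2 \<le> h" "h \<le> m" "x \<le> h" "lambda_poly m (of_nat x) = of_int l" "int h dvd l"
  shows "x + 2 \<le> m"
proof (rule ccontr)
  assume "\<not> x + 2 \<le> m"
  define k where "k = m - 2"
  have m: "m = k + 2"
    using assms k_def by simp
  define r where "r = (2 * k + 1) choose k"
  have "r > 0"
    by (simp add: r_def)
  note closed_form = lambda_poly_closed_form[of k x, folded m r_def]
  from \<open>\<not> x + 2 \<le> m\<close> assms consider "x = k + 1" | "x = k + 2"
    unfolding m by linarith
  then have "\<bar>lambda_poly m (of_nat x)\<bar>
      = (if x = k + 1 then 1 else of_nat (2 * k + 3)) / of_nat r"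
  proof cases
    case 1
    have "(2 * k + 2) choose (k + 1) = 2 * r"
      using binomial_symmetric[of k "2 * k + 1"] by (simp add: r_def mult_2)
    then have u: "(x + k + 1) choose (k + 1) = 2 * r"
      using 1 by (simp add: mult_2)
    have v: "x choose (k + 1) = 1"
      using 1 by simp
    show ?thesis
      unfolding closed_form u v using 1 \<open>r > 0\<close>
      by (simp add: abs_mult power_abs power2_eq_square)
  next
    case 2
    have "x + k + 1 = 2 * Suc k + 1" "k + 1 = Suc k"
      using 2 by simp_all
    then have "(k + 2) * ((x + k + 1) choose (k + 1)) = 2 * (2 * k + 3) * r"
      by (simp only: odd_central_binomial_step r_def)
    then have "of_nat (k + 2) * rat_of_nat ((x + k + 1) choose (k + 1))
        = 2 * of_nat (2 * k + 3) * of_nat r"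
      by (metis of_nat_mult of_nat_numeral)
    then have u: "rat_of_nat ((x + k + 1) choose (k + 1))
        = 2 * of_nat (2 * k + 3) * of_nat r / of_nat (k + 2)"
      by (subst nonzero_eq_divide_eq) (auto simp: mult_ac simp del: of_nat_add binomial_Suc_Suc)
    have v: "x choose (k + 1) = k + 2"
      using 2 binomial_Suc_n[of "k + 1"] by simp
    show ?thesis
      unfolding closed_form u v using 2 \<open>r > 0\<close>
      by (simp add: abs_mult power_abs power2_eq_square del: of_nat_add)
  qed
  moreover have "\<bar>lambda_poly m (of_nat x)\<bar> = of_int \<bar>l\<bar>"
    using assms(4) by simp
  ultimately have l: "of_int \<bar>l\<bar> = ((if x = k + 1 then 1 else of_nat (2 * k + 3)) / of_nat r :: rat)"
    by simp
  then have "l \<noteq> 0"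
    using \<open>r > 0\<close> by (auto split: if_splits)
  then have "int h \<le> \<bar>l\<bar>"
    using dvd_imp_le_int[OF \<open>l \<noteq> 0\<close> assms(5)] by simp
  then have "2 \<le> \<bar>l\<bar>"
    using assms(1) by linarith
  have "rat_of_int (\<bar>l\<bar> * int r) = of_int (if x = k + 1 then 1 else 2 * int k + 3)"
    using l \<open>r > 0\<close> by (simp add: field_simps split: if_splits)
  then have lr: "\<bar>l\<bar> * int r = (if x = k + 1 then 1 else 2 * int k + 3)"
    by (simp only: of_int_eq_iff)
  show False
  proof (cases "k = 0")
    case True
    then have "h = 2" "r = 1"
      using assms(1,2) by (simp_all add: m r_def)
    with True lr have "l = 1 \<or> l = -1 \<or> l = 3 \<or> l = -3"
      by (auto simp: abs_if split: if_splits)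
    with assms(5) \<open>h = 2\<close> show False
      by auto
  next
    case False
    then have "int (2 * k + 1) \<le> int r"
      unfolding r_def using odd_central_binomial_ge[of k] by linarith
    with \<open>2 \<le> \<bar>l\<bar>\<close> have "2 * int (2 * k + 1) \<le> \<bar>l\<bar> * int r"
      by (intro mult_mono) auto
    with lr False show False
      by (auto split: if_splits)
  qed
qed

section \<open>The congruence\<close>

theorem corollary2p5:
  fixes h m x n :: nat
  assumes "2 \<le> h" and "h \<le> m" and "x \<le> h"
    and "\<exists>k :: int. lambda_poly m (of_nat x) = of_int k \<and> int h dvd k"
  shows "rat_cong
    (of_nat ((x + n) choose n))
    ((\<Sum>i = 1..n.
        if i \<le> m
        then of_nat ((x + m) choose i) * of_nat ((x + n - i) choose (n - i))
             * (fact m / fact (m - i)) * (fact (2 * m - 1 - i) / fact (2 * m - 1))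
             * (-1) ^ (i + 1)
        else 0)
     + (if n < m
        then ((of_nat x + of_nat n - of_nat m) gchoose n)
             * of_nat ((m - 1) choose n) * inverse (of_nat ((2 * m - 1) choose n))
        else 0))
    h"
proof -
  have x: "x + 2 \<le> m"
    using assms lambda_poly_divisible_imp_bound by blast
  define N where "N = 2 * m - 1"
  \<comment> \<open>The denominator and the numerator of the Pade approximant, and the series that it
    approximates.\<close>
  define q where "q = hyper_coeff (- of_nat m) (- of_nat (x + m)) (- rat_of_nat N)"
  define p where "p = hyper_coeff (- of_nat (m - 1)) (- of_nat (m - 1 - x)) (- rat_of_nat N)"
  define W where "W = Abs_fps (\<lambda>n. rat_of_nat ((x + n) choose n))"
  have Nsub: "N - (m - 1) = m" "N - (m - 1 - x) = x + m" "m - (m - 1 - x) = Suc x"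
    "m - 1 + (m - 1 - x) \<le> N"
    using x by (auto simp: N_def)
  have le: "m - 1 \<le> N" "m \<le> N"
    using x by (auto simp: N_def)
  have bound: "n \<le> m - 1 \<longleftrightarrow> n < m"
    using x by auto
  have top: "- of_nat (m - 1 - x) + of_nat n - 1 = (of_nat x + of_nat n - of_nat m :: rat)"
    using x by (simp add: of_nat_diff)
  have "Abs_fps q = (1 - fps_X) ^ Suc x * Abs_fps p"
    using euler_transformation_nonpos_int[of "m - 1" "m - 1 - x" N, where 'a=rat]
    unfolding Nsub q_def p_def using Nsub(4) by blast
  then have "Abs_fps q * W = ((1 - fps_X) ^ Suc x * W) * Abs_fps p"
    by (simp only: mult_ac)
  then have "Abs_fps q * W = Abs_fps p"
    by (simp only: W_def one_minus_fps_X_power_mult_binomial mult_1_left)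
  then have "(\<Sum>i = 0..n. q i * of_nat ((x + (n - i)) choose (n - i))) = p n"
    using fps_mult_nth[of "Abs_fps q" W n] by (simp add: W_def)
  then have "of_nat ((x + n) choose n)
      = (\<Sum>i = 1..n. - (q i * of_nat ((x + (n - i)) choose (n - i)))) + p n"
    by (simp add: sum.atLeast_Suc_atMost q_def sum_negf)
  also have "p n = (if n < m
        then ((of_nat x + of_nat n - of_nat m) gchoose n)
             * of_nat ((m - 1) choose n) * inverse (of_nat ((2 * m - 1) choose n))
        else 0)"
    unfolding p_def hyper_coeff_nonpos_int_gbinomial[OF le(1)] top bound
    unfolding N_def ..
  also have "(\<Sum>i = 1..n. - (q i * of_nat ((x + (n - i)) choose (n - i))))
     = (\<Sum>i = 1..n.
        if i \<le> m
        then of_nat ((x + m) choose i) * of_nat ((x + n - i) choose (n - i))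
             * (fact m / fact (m - i)) * (fact (2 * m - 1 - i) / fact (2 * m - 1))
             * (-1) ^ (i + 1)
        else 0)"
  proof (intro sum.cong refl)
    fix i
    assume "i \<in> {1..n}"
    then have "x + (n - i) = x + n - i"
      by simp
    then show "- (q i * of_nat ((x + (n - i)) choose (n - i)))
      = (if i \<le> m
        then of_nat ((x + m) choose i) * of_nat ((x + n - i) choose (n - i))
             * (fact m / fact (m - i)) * (fact (2 * m - 1 - i) / fact (2 * m - 1))
             * (-1) ^ (i + 1)
        else 0)"
      unfolding q_def hyper_coeff_nonpos_int[OF le(2)] by (simp only: N_def) (simp add: mult_ac)
  qed
  finally show ?thesis
    by (simp only: rat_cong_def diff_self div_0 Ints_0)
qed

end
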